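(* Let $f \in \mathbb{K}[z]$ be a polynomial of degree $n \ge 2$. Suppose there exists a vector $x \in \mathbb{K}^n$ with distinct components such that $$E_f(x) = \left\| \frac{W_f(x)}{d(x)} \right\|_p \le \frac{1}{(1+\sqrt{a})^2}$$ for some $1 \le p \le \infty$, where $a = (n-1)^{1/q}$ and $q$ is the conjugate exponent of $p$. In the case $n = 2$ and $p = \infty$, assume that this inequality is strict. Then $f$ has only simple zeros and there exists a root-vector $\xi \in \mathbb{K}^n$ of $f$ such that $$\left\| \frac{x-\xi}{d(x)} \right\|_p \le \frac{2E_f(x)}{1-(a-1)E_f(x)+\sqrt{(1-(a-1)E_f(x))^2-4E_f(x)}}.$$
   Context: $(\mathbb{K},|\cdot|)$ is an algebraically closed normed field (a field with an absolute value) and $\mathbb{K}[z]$ is the ring of polynomials over $\mathbb{K}$. For $1 \le p \le \infty$, the $p$-norm on $\mathbb{K}^n$ and on $\mathbb{R}^n$ is $\|x\|_p = \left(\sum_{i=1}^n |x_i|^p\right)^{1/p}$ ($\|x\|_\infty = \max_i |x_i|$). The conjugate exponent $q$ of $p$ is defined by $1 \le q \le \infty$ and $1/p+1/q=1$ (with $1/\infty = 0$). For $x \in \mathbb{K}^n$, $d(x) = (d_1(x),\ldots,d_n(x)) \in \mathbb{R}^n$ with $d_i(x) = \min_{j\ne i}|x_i-x_j|$. For $x \in \mathbb{K}^n$ and $y \in \mathbb{R}^n$ with no zero components, $\frac{x}{y} = \left(\frac{|x_1|}{y_1},\ldots,\frac{|x_n|}{y_n}\right) \in \mathbb{R}^n$.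 For a polynomial $f \in \mathbb{K}[z]$ of degree $n \ge 2$ with leading coefficient $a_0$ and a vector $x \in \mathbb{K}^n$ with distinct components, the Weierstrass correction is $W_f(x) = (W_1(x),\ldots,W_n(x))$ with $W_i(x) = \frac{f(x_i)}{a_0\prod_{j\ne i}(x_i-x_j)}$. A vector $\xi \in \mathbb{K}^n$ is a root-vector of $f$ if $f(z) = a_0\prod_{i=1}^n (z-\xi_i)$ for all $z \in \mathbb{K}$. *)

theory Defs
  imports
    "HOL-Analysis.Analysis"
    "HOL-Computational_Algebra.Computational_Algebra"
begin

(* The library's normed fields are real algebras, hence of characteristic 0 and archimedean.
   A general normed field (any characteristic, archimedean or not, not necessarily complete)
   is a field with an explicit absolute value. *)
locale absolute_value =
  fixes v :: "'a :: field \<Rightarrow> real"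
  assumes nonneg: "0 \<le> v x"
    and eq_zero_iff: "v x = 0 \<longleftrightarrow> x = 0"
    and mult: "v (x * y) = v x * v y"
    and triangle: "v (x + y) \<le> v x + v y"

definition p_norm :: "ennreal \<Rightarrow> real ^ 'n \<Rightarrow> real" where
  "p_norm p x =
     (if p = \<infinity> then Max (range (\<lambda>i. \<bar>x $ i\<bar>))
      else (\<Sum>i\<in>UNIV. \<bar>x $ i\<bar> powr enn2real p) powr (1 / enn2real p))"

(* In ennreal, 1 / 0 = \<infinity> and 1 / \<infinity> = 0. *)
definition conjugate_exponents :: "ennreal \<Rightarrow> ennreal \<Rightarrow> bool" where
  "conjugate_exponents p q \<longleftrightarrow> 1 \<le> p \<and> 1 \<le> q \<and> 1 / p + 1 / q = 1"

(* Meaningful for CARD('n) at least 2; otherwise the minimum is over the empty set. *)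
definition min_dist :: "('a \<Rightarrow> real) \<Rightarrow> ('a :: field) ^ 'n \<Rightarrow> real ^ 'n" where
  "min_dist v x = (\<chi> i. Min ((\<lambda>j. v (x $ i - x $ j)) ` (UNIV - {i})))"

definition vec_quotient :: "('a \<Rightarrow> real) \<Rightarrow> ('a :: field) ^ 'n \<Rightarrow> real ^ 'n \<Rightarrow> real ^ 'n" where
  "vec_quotient v x y = (\<chi> i. v (x $ i) / y $ i)"

definition weierstrass_correction :: "('a :: field) poly \<Rightarrow> 'a ^ 'n \<Rightarrow> 'a ^ 'n" where
  "weierstrass_correction f x =
     (\<chi> i. poly f (x $ i) / (lead_coeff f * (\<Prod>j\<in>UNIV - {i}. x $ i - x $ j)))"

definition E_func ::
    "('a \<Rightarrow> real) \<Rightarrow> ennreal \<Rightarrow> ('a :: field) poly \<Rightarrow> 'a ^ 'n \<Rightarrow> real" where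
  "E_func v p f x = p_norm p (vec_quotient v (weierstrass_correction f x) (min_dist v x))"

definition is_root_vector :: "('a :: field) poly \<Rightarrow> 'a ^ 'n \<Rightarrow> bool" where
  "is_root_vector f \<xi> \<longleftrightarrow> (\<forall>z. poly f z = lead_coeff f * (\<Prod>i\<in>UNIV. z - \<xi> $ i))"

end

theory Submission
  imports Defs
begin

text \<open>
  Write \<open>W\<^sub>j\<close> for the Weierstrass corrections, \<open>d\<^sub>j\<close> for the components of \<open>d(x)\<close>,
  \<open>e\<^sub>j = |W\<^sub>j| / d\<^sub>j\<close>, and \<open>t\<close> for the claimed bound.  Lagrange interpolation
  (\<open>weierstrass_interpolation\<close>) gives \<open>f(z) = a\<^sub>0 \<Prod>(z - x\<^sub>j) (1 + \<Sum> W\<^sub>j / (z - x\<^sub>j))\<close>, so near \<open>x\<^sub>i\<close>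
  the roots of \<open>f\<close> are the fixed points of
  \<open>G(z) = x\<^sub>i - W\<^sub>i / A(z)\<close>, where \<open>A(z) = 1 + \<Sum> W\<^sub>j / (z - x\<^sub>j)\<close> with the sum over \<open>j \<noteq> i\<close>.
  The roots are found one at a time, each in its own disc \<open>|z - x\<^sub>i| \<le> t d\<^sub>i\<close>, by iterating this map
  in one variable.

  On the disc of radius \<open>r d\<^sub>i\<close> the modulus of \<open>A\<close> is at least \<open>1 - S / (1 - r)\<close>, where
  \<open>S = \<Sum> e\<^sub>j\<close> over \<open>j \<noteq> i\<close>, and \<open>G\<close> is majorized, increments included, by the real function
  \<open>e\<^sub>i / (1 - S / (1 - r))\<close>.  The inequality of Hoelder (\<open>holder_sum_others\<close>) gives \<open>S \<le> a E\<close>, and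
  \<open>t\<close> is exactly the smaller solution of \<open>t = E / (1 - a E / (1 - t))\<close> (\<open>majorant_root\<close>), which is
  real for \<open>E\<close> up to the bound assumed here.  Hence the iterates of \<open>G\<close> from \<open>x\<^sub>i\<close> stay
  in the disc and their increments tend to \<open>0\<close> (\<open>majorant_approximate_fixed_point\<close>), so \<open>f\<close> takes
  arbitrarily small values on the disc.  The field need not be complete, and the iterates are not
  shown to converge; instead, \<open>f\<close> splits into finitely many linear factors, and small values
  of \<open>f\<close> force a root in the closed disc (\<open>root_in_disc\<close>).

  A root \<open>\<xi>\<^sub>i\<close> in the disc satisfies the fixed point equation exactly, whence
  \<open>|\<xi>\<^sub>i - x\<^sub>i| / d\<^sub>i \<le> e\<^sub>i / (1 - a E / (1 - t))\<close> (\<open>root_distance_le_correction\<close>).  This factor does not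
  depend on \<open>i\<close>, so taking \<open>p\<close>-norms gives the bound \<open>E / (1 - a E / (1 - t)) = t\<close>.

  The roots \<open>\<xi>\<^sub>i\<close> are distinct.  Since \<open>t \<le> 1 / (1 + sqrt a) \<le> 1/2\<close> and \<open>d\<^sub>i\<close>, \<open>d\<^sub>j\<close> are at most
  \<open>|x\<^sub>i - x\<^sub>j|\<close>, a collision \<open>\<xi>\<^sub>i = \<xi>\<^sub>j\<close> needs \<open>t = 1/2\<close> and two components equal to \<open>1/2\<close>.
  For finite \<open>p\<close> the \<open>p\<close>-norm would then exceed \<open>1/2\<close>; for infinite \<open>p\<close>, \<open>t = 1/2\<close> means \<open>a = 1\<close>,
  that is \<open>n = 2\<close>, where the strict inequality is assumed and gives \<open>t < 1/2\<close>.  Having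
  \<open>n\<close> distinct roots, \<open>f\<close> has only simple ones and \<open>\<xi>\<close> is a root-vector.
\<close>

section \<open>Absolute values on a field\<close>

context absolute_value
begin

lemma zero [simp]: "v 0 = 0"
  by (simp add: eq_zero_iff)

lemma one [simp]: "v 1 = 1"
proof -
  have "v 1 * v 1 = v 1" using mult[of 1 1] by simp
  moreover have "v 1 \<noteq> 0" by (simp add: eq_zero_iff)
  ultimately show ?thesis by simp
qed

lemma minus [simp]: "v (- x) = v x"
proof -
  have "v (- 1) * v (- 1) = 1" using mult[of "- 1" "- 1"] by simp
  then have "v (- 1) = 1"
    using nonneg[of "- 1"] by (metis abs_of_nonneg abs_square_eq_1 power2_eq_square)
  then show ?thesis using mult[of "- 1" x] by simp
qed

lemma diff_commute: "v (x - y) = v (y - x)"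
  using minus[of "x - y"] by simp

lemma diff_triangle: "v (x - z) \<le> v (x - y) + v (y - z)"
  using triangle[of "x - y" "y - z"] by simp

lemma triangle_lower: "v x - v y \<le> v (x + y)"
  using triangle[of "x + y" "- y"] by simp

lemma inverse: "v (inverse x) = inverse (v x)"
proof (cases "x = 0")
  case False
  then have "v x * v (inverse x) = 1" by (simp flip: mult)
  then show ?thesis by (simp add: inverse_unique)
qed simp

lemma divide: "v (x / y) = v x / v y"
  by (simp add: divide_inverse mult inverse)

lemma prod: "v (\<Prod>j\<in>A. g j) = (\<Prod>j\<in>A. v (g j))"
  by (induction A rule: infinite_finite_induct) (auto simp: mult)

lemma sum_le: "v (\<Sum>j\<in>A. g j) \<le> (\<Sum>j\<in>A. v (g j))"
proof (induction A rule: infinite_finite_induct)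
  case (insert a A)
  then show ?case using triangle[of "g a" "sum g A"] by simp
qed auto

lemma pos: "x \<noteq> 0 \<Longrightarrow> 0 < v x"
  using nonneg[of x] eq_zero_iff[of x] by linarith

end

text \<open>The value of \<open>f\<close> is its leading coefficient times one linear factor per root, so a small
  value forces a small factor.  This replaces any passage to a limit of approximate
  roots, for which the field might lack completeness.\<close>

lemma small_value_imp_near_root:
  fixes f :: "'a :: alg_closed_field poly"
  assumes "absolute_value v" "f \<noteq> 0" "0 < \<delta>" "v (poly f z) < v (lead_coeff f) * \<delta> ^ degree f"
  obtains \<zeta> where "poly f \<zeta> = 0" "v (z - \<zeta>) < \<delta>"
proof -
  interpret v: absolute_value v by fact
  obtain A where A: "size A = degree f" "f = smult (lead_coeff f) (\<Prod>x\<in>#A. [:-x, 1:])"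
    using alg_closed_imp_factorization[OF \<open>f \<noteq> 0\<close>] by blast
  have root: "poly f \<zeta> = 0" if "\<zeta> \<in># A" for \<zeta>
    using that by (subst A(2)) (auto simp: poly_prod_mset image_iff)
  have val: "poly f z = lead_coeff f * (\<Prod>x\<in>#A. z - x)"
    by (subst A(2)) (simp add: poly_prod_mset)
  have "\<exists>\<zeta>\<in>#A. v (z - \<zeta>) < \<delta>"
  proof (rule ccontr)
    assume "\<not> (\<exists>\<zeta>\<in>#A. v (z - \<zeta>) < \<delta>)"
    then have "\<delta> ^ size A \<le> v (\<Prod>x\<in>#A. z - x)"
    proof (induction A)
      case (add x A)
      then have "\<delta> * \<delta> ^ size A \<le> v (z - x) * v (\<Prod>x\<in>#A. z - x)"
        using \<open>0 < \<delta>\<close> by (intro mult_mono) (auto simp: v.nonneg not_less)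
      then show ?case by (simp add: v.mult)
    qed simp
    then have "v (lead_coeff f) * \<delta> ^ degree f \<le> v (poly f z)"
      unfolding val v.mult A(1)[symmetric] by (intro mult_left_mono) (auto simp: v.nonneg)
    then show False using assms(4) by simp
  qed
  then show ?thesis using root that by blast
qed

section \<open>Polynomials with prescribed distinct nodes\<close>

lemma degree_linear_prod:
  fixes y :: "'i \<Rightarrow> 'a :: field"
  shows "degree (\<Prod>j\<in>A. [:- y j, 1:]) = card A"
  by (subst degree_prod_sum_eq) auto

lemma poly_linear_prod:
  fixes y :: "'i \<Rightarrow> 'a :: field"
  shows "poly (\<Prod>j\<in>A. [:- y j, 1:]) z = (\<Prod>j\<in>A. z - y j)"
  by (auto simp: poly_prod intro!: prod.cong)

lemma coeff_linear_prod:
  fixes y :: "'i \<Rightarrow> 'a :: field"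
  shows "coeff (\<Prod>j\<in>A. [:- y j, 1:]) (card A) = 1"
  using lead_coeff_prod[of "\<lambda>j. [:- y j, 1:]" A] by (simp add: degree_linear_prod)

text \<open>Two polynomials of degree \<open>n\<close> with the same leading coefficient are equal if they agree
  at \<open>n\<close> points, so \<open>n\<close> distinct roots already form a root-vector.\<close>

lemma distinct_roots_imp_root_vector:
  fixes f :: "'a :: field poly" and \<xi> :: "'a ^ 'n"
  assumes "degree f = CARD('n)" "inj (\<lambda>i. \<xi> $ i)" "\<And>i. poly f (\<xi> $ i) = 0"
  shows "f = smult (lead_coeff f) (\<Prod>i\<in>UNIV. [:- \<xi> $ i, 1:])"
proof (rule poly_eqI_degree_lead_coeff[where A = "range (\<lambda>i. \<xi> $ i)" and n = "CARD('n)"])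
  show "coeff f CARD('n) = coeff (smult (lead_coeff f) (\<Prod>i\<in>UNIV. [:- \<xi> $ i, 1:])) CARD('n)"
    using coeff_linear_prod[of "\<lambda>i. \<xi> $ i" "UNIV :: 'n set"] assms(1) by simp
  show "card (range (\<lambda>i. \<xi> $ i)) \<ge> CARD('n)"
    using assms(2) by (simp add: card_image)
  show "degree (smult (lead_coeff f) (\<Prod>i\<in>UNIV. [:- \<xi> $ i, 1:])) \<le> CARD('n)"
    using degree_linear_prod[of "\<lambda>i. \<xi> $ i" "UNIV :: 'n set"] by (metis degree_smult_le)
  fix z assume "z \<in> range (\<lambda>i. \<xi> $ i)"
  then show "poly f z = poly (smult (lead_coeff f) (\<Prod>i\<in>UNIV. [:- \<xi> $ i, 1:])) z"
    using assms(3) by (auto simp: poly_linear_prod)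
qed (use assms(1) in simp)

lemma order_linear_prod:
  fixes y :: "'i \<Rightarrow> 'a :: field"
  assumes "finite A" "inj_on y A" "i \<in> A" "c \<noteq> 0"
  shows "order (y i) (smult c (\<Prod>j\<in>A. [:- y j, 1:])) = 1"
proof -
  let ?g = "\<Prod>j\<in>A - {i}. [:- y j, 1:]"
  have "poly ?g (y i) \<noteq> 0"
    using assms by (auto simp: poly_linear_prod dest: inj_onD)
  then have g: "?g \<noteq> 0" "order (y i) ?g = 0"
    by (metis poly_0, rule order_0I)
  have "order (y i) [:- y i, 1:] = 1"
    using order_power_n_n[of "y i" 1] by simp
  then have "order (y i) ([:- y i, 1:] * ?g) = 1"
    using g by (subst order_mult) (simp_all del: mult_pCons_left)
  moreover have "(\<Prod>j\<in>A. [:- y j, 1:]) = [:- y i, 1:] * ?g"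
    using assms by (intro prod.remove)
  ultimately show ?thesis
    using order_smult[OF assms(4)] by metis
qed

text \<open>Lagrange interpolation of \<open>f\<close> at the nodes: the corrections are the partial fraction
  coefficients of \<open>f\<close> divided by its monic nodal polynomial.\<close>

lemma weierstrass_interpolation:
  fixes f :: "'a :: field poly" and x :: "'a ^ 'n"
  assumes deg: "degree f = CARD('n)" and inj: "\<And>i j. i \<noteq> j \<Longrightarrow> x $ i \<noteq> x $ j"
  shows "poly f z = lead_coeff f * ((\<Prod>j\<in>UNIV. z - x $ j) +
           (\<Sum>j\<in>UNIV. weierstrass_correction f x $ j * (\<Prod>k\<in>UNIV - {j}. z - x $ k)))"
proof -
  let ?W = "\<lambda>j. weierstrass_correction f x $ j"
  let ?P = "\<lambda>A. \<Prod>k\<in>A. [:- x $ k, 1:]"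
  define r where "r = (\<Sum>j\<in>UNIV. smult (?W j) (?P (UNIV - {j})))"
  have c0: "lead_coeff f \<noteq> 0" using deg by (metis degree_0 leading_coeff_0_iff zero_less_card_finite less_irrefl)
  have degr: "degree r < CARD('n)"
    unfolding r_def
  proof (rule degree_sum_less)
    fix j :: 'n
    have "degree (smult (?W j) (?P (UNIV - {j}))) \<le> CARD('n) - 1"
      using degree_linear_prod[of "\<lambda>k. x $ k" "UNIV - {j}"]
      by (metis degree_smult_le card_Diff_singleton UNIV_I)
    then show "degree (smult (?W j) (?P (UNIV - {j}))) < CARD('n)"
      by (metis Suc_pred' le_imp_less_Suc zero_less_card_finite)
  qed simp
  have polyr: "poly r z = (\<Sum>j\<in>UNIV. ?W j * (\<Prod>k\<in>UNIV - {j}. z - x $ k))" for z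
    by (simp add: r_def poly_sum poly_linear_prod)
  have "f = smult (lead_coeff f) (?P UNIV + r)"
  proof (rule poly_eqI_degree_lead_coeff[where A = "range (\<lambda>i. x $ i)" and n = "CARD('n)"])
    show "coeff f CARD('n) = coeff (smult (lead_coeff f) (?P UNIV + r)) CARD('n)"
      using coeff_linear_prod[of "\<lambda>i. x $ i" "UNIV :: 'n set"] deg degr
      by (simp add: coeff_eq_0)
    have "inj (\<lambda>i. x $ i)" using inj by (auto simp: inj_def)
    then show "card (range (\<lambda>i. x $ i)) \<ge> CARD('n)" by (simp add: card_image)
    show "degree (smult (lead_coeff f) (?P UNIV + r)) \<le> CARD('n)"
      using degree_linear_prod[of "\<lambda>i. x $ i" "UNIV :: 'n set"] degr
      by (intro order_trans[OF degree_smult_le] degree_add_le) auto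
  next
    fix z assume "z \<in> range (\<lambda>i. x $ i)"
    then obtain i where z: "z = x $ i" by auto
    have nz: "(\<Prod>k\<in>UNIV - {i}. x $ i - x $ k) \<noteq> 0" using inj by auto
    have "(\<Prod>k\<in>UNIV - {j}. x $ i - x $ k) = 0" if "j \<noteq> i" for j
      using that by auto
    then have "poly r z = (\<Sum>j\<in>UNIV. if j = i then ?W i * (\<Prod>k\<in>UNIV - {i}. x $ i - x $ k) else 0)"
      unfolding polyr z by (intro sum.cong) auto
    then have "poly r z = ?W i * (\<Prod>k\<in>UNIV - {i}. x $ i - x $ k)" by simp
    moreover have "poly (?P UNIV) z = 0"
      unfolding poly_linear_prod z by (intro prod_zero) auto
    ultimately show "poly f z = poly (smult (lead_coeff f) (?P UNIV + r)) z"
      using nz c0 by (simp add: z weierstrass_correction_def)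
  qed (use deg in simp)
  then have "poly f z = poly (smult (lead_coeff f) (?P UNIV + r)) z" by simp
  then show ?thesis by (simp add: poly_linear_prod polyr)
qed

text \<open>Away from the other nodes, and where the cofactor \<open>A z\<close> of \<open>z - x\<^sub>i\<close> in the last factor is
  nonzero, \<open>f z = 0\<close> is thus the fixed point equation \<open>z = x\<^sub>i - W\<^sub>i / A z\<close>.  The node \<open>x\<^sub>i\<close>
  itself is an admissible value of \<open>z\<close>, as its pole has been cleared.\<close>

lemma weierstrass_fixed_point_form:
  fixes f :: "'a :: field poly" and x :: "'a ^ 'n"
  assumes "degree f = CARD('n)" "\<And>i j. i \<noteq> j \<Longrightarrow> x $ i \<noteq> x $ j"
    and z: "\<And>j. j \<noteq> i \<Longrightarrow> z \<noteq> x $ j"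
  shows "poly f z = lead_coeff f * (\<Prod>j\<in>UNIV - {i}. z - x $ j) *
           ((z - x $ i) * (1 + (\<Sum>j\<in>UNIV - {i}. weierstrass_correction f x $ j / (z - x $ j)))
             + weierstrass_correction f x $ i)"
proof -
  let ?W = "\<lambda>j. weierstrass_correction f x $ j"
  let ?Q = "\<Prod>j\<in>UNIV - {i}. z - x $ j"
  have all: "(\<Prod>j\<in>UNIV. z - x $ j) = (z - x $ i) * ?Q"
    by (simp add: prod.remove[of UNIV i])
  have "(\<Prod>k\<in>UNIV - {j}. z - x $ k) = (z - x $ i) * ?Q / (z - x $ j)" if "j \<noteq> i" for j
    unfolding all[symmetric] using z[OF that] by (simp add: prod.remove[of UNIV j])
  then have "(\<Sum>j\<in>UNIV. ?W j * (\<Prod>k\<in>UNIV - {j}. z - x $ k))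
      = ?W i * ?Q + (\<Sum>j\<in>UNIV - {i}. (z - x $ i) * ?Q * (?W j / (z - x $ j)))"
    by (subst sum.remove[of UNIV i]) (auto intro!: sum.cong)
  also have "\<dots> = ?W i * ?Q + (z - x $ i) * ?Q * (\<Sum>j\<in>UNIV - {i}. ?W j / (z - x $ j))"
    by (simp add: sum_distrib_left)
  finally have sum: "(\<Sum>j\<in>UNIV. ?W j * (\<Prod>k\<in>UNIV - {j}. z - x $ k)) = \<dots>" .
  have "poly f z = lead_coeff f * ((\<Prod>j\<in>UNIV. z - x $ j)
      + (\<Sum>j\<in>UNIV. ?W j * (\<Prod>k\<in>UNIV - {j}. z - x $ k)))"
    using weierstrass_interpolation[OF assms(1,2)] .
  then show ?thesis
    unfolding all sum by (simp add: distrib_left distrib_right ac_simps)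
qed

section \<open>A root in each disc\<close>

context absolute_value
begin

text \<open>Kantorovich's majorant principle: the increments of the iterates of \<open>G\<close> from \<open>c\<close> are
  bounded by those of the real sequence \<open>m\<^sup>k 0\<close>, which increases and is bounded by \<open>t\<close>, so that its
  increments tend to \<open>0\<close>.  No contraction constant is involved, and \<open>m t = t\<close> may be a double
  fixed point.  The iterates need not converge, hence the conclusion is an approximate fixed
  point only.\<close>

lemma majorant_approximate_fixed_point:
  fixes G :: "'a \<Rightarrow> 'a" and m :: "real \<Rightarrow> real"
  assumes start: "v (G c - c) \<le> m 0 * D" "0 \<le> m 0"
    and step: "\<And>w z r r'. 0 \<le> r \<Longrightarrow> r \<le> r' \<Longrightarrow> r' \<le> t \<Longrightarrow> v (w - c) \<le> r * D \<Longrightarrow>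
                 v (z - w) \<le> (r' - r) * D \<Longrightarrow> v (G z - G w) \<le> (m r' - m r) * D"
    and mono: "\<And>r r'. 0 \<le> r \<Longrightarrow> r \<le> r' \<Longrightarrow> r' \<le> t \<Longrightarrow> m r \<le> m r'"
    and t: "0 \<le> t" "m t \<le> t" and "0 < D" "0 < \<epsilon>"
  shows "\<exists>z. v (z - c) \<le> t * D \<and> v (G z - z) < \<epsilon>"
proof -
  define r where "r k = (m ^^ k) 0" for k
  define z where "z k = (G ^^ k) c" for k
  have iter: "r (Suc k) = m (r k)" "z (Suc k) = G (z k)" for k
    by (simp_all add: r_def z_def)
  have r: "0 \<le> r k \<and> r k \<le> r (Suc k) \<and> r (Suc k) \<le> t" for k
  proof (induction k)
    case 0
    then show ?case using mono[of 0 t] start t by (simp add: r_def)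
  next
    case (Suc k)
    then have "0 \<le> r (Suc k)" by linarith
    moreover have "m (r k) \<le> m (r (Suc k))" "m (r (Suc k)) \<le> m t"
      using mono[of "r k" "r (Suc k)"] mono[of "r (Suc k)" t] Suc \<open>0 \<le> r (Suc k)\<close> by blast+
    ultimately show ?case using t unfolding iter by linarith
  qed
  have z: "v (z k - c) \<le> r k * D \<and> v (z (Suc k) - z k) \<le> (r (Suc k) - r k) * D" for k
  proof (induction k)
    case 0
    then show ?case using start by (simp add: r_def z_def)
  next
    case (Suc k)
    have "v (z (Suc k) - c) \<le> r (Suc k) * D"
      using Suc diff_triangle[of "z (Suc k)" c "z k"] by (simp add: algebra_simps)
    moreover have "v (G (z (Suc k)) - G (z k)) \<le> (m (r (Suc k)) - m (r k)) * D"
      using Suc r[of k] by (intro step) blast+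
    then have "v (z (Suc (Suc k)) - z (Suc k)) \<le> (r (Suc (Suc k)) - r (Suc k)) * D"
      by (simp only: iter)
    ultimately show ?case by simp
  qed
  have "incseq r" using r by (intro incseq_SucI) blast
  moreover have "\<forall>k. r k \<le> t" using r by (meson order_trans)
  ultimately obtain L where L: "r \<longlonglongrightarrow> L" by (rule incseq_convergent)
  have "(\<lambda>k. (r (Suc k) - r k) * D) \<longlonglongrightarrow> (L - L) * D"
    by (rule tendsto_mult[OF tendsto_diff[OF LIMSEQ_Suc[OF L] L] tendsto_const])
  then have "eventually (\<lambda>k. (r (Suc k) - r k) * D < \<epsilon>) sequentially"
    using \<open>0 < \<epsilon>\<close> by (intro order_tendstoD) auto
  then obtain k where "(r (Suc k) - r k) * D < \<epsilon>"
    by (meson eventually_happens' sequentially_bot)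
  then have "v (G (z k) - z k) < \<epsilon>" using z[of k] by (simp add: iter)
  moreover have "v (z k - c) \<le> t * D"
    using z[of k] r[of k] \<open>0 < D\<close> by (meson mult_right_mono less_imp_le order_trans)
  ultimately show ?thesis by blast
qed

lemma disc_avoids_node:
  assumes "D \<le> v (c - y)" "v (z - c) \<le> r * D" "0 \<le> r"
  shows "(1 - r) * v (c - y) \<le> v (z - y)"
proof -
  have "r * D \<le> r * v (c - y)" using assms by (intro mult_left_mono) auto
  moreover have "v (c - y) \<le> v (c - z) + v (z - y)" by (rule diff_triangle)
  ultimately show ?thesis using assms(2) by (simp add: diff_commute[of c z] algebra_simps)
qed

lemma partial_fractions_bound:
  fixes W y :: "'i \<Rightarrow> 'a"
  assumes d: "\<And>j. j \<in> J \<Longrightarrow> 0 < d j \<and> d j \<le> v (c - y j) \<and> D \<le> v (c - y j)"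
    and r: "0 \<le> r" "r < 1" "v (z - c) \<le> r * D"
  shows "v (\<Sum>j\<in>J. W j / (z - y j)) \<le> (\<Sum>j\<in>J. v (W j) / d j) / (1 - r)"
proof -
  have "v (\<Sum>j\<in>J. W j / (z - y j)) \<le> (\<Sum>j\<in>J. v (W j) / v (z - y j))"
    using sum_le[of "\<lambda>j. W j / (z - y j)" J] by (simp add: divide)
  also have "\<dots> \<le> (\<Sum>j\<in>J. v (W j) / ((1 - r) * d j))"
  proof (rule sum_mono)
    fix j assume j: "j \<in> J"
    have pos: "0 < (1 - r) * d j" using d[OF j] r by simp
    have "(1 - r) * d j \<le> (1 - r) * v (c - y j)" using d[OF j] r by (intro mult_left_mono) auto
    also have "\<dots> \<le> v (z - y j)" using disc_avoids_node d[OF j] r by blast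
    finally show "v (W j) / v (z - y j) \<le> v (W j) / ((1 - r) * d j)"
      using pos nonneg by (intro frac_le) auto
  qed
  also have "\<dots> = (\<Sum>j\<in>J. v (W j) / d j) / (1 - r)"
    by (simp add: sum_divide_distrib mult.commute)
  finally show ?thesis .
qed

lemma denominator_lower_bound:
  fixes W y :: "'i \<Rightarrow> 'a"
  assumes "\<And>j. j \<in> J \<Longrightarrow> 0 < d j \<and> d j \<le> v (c - y j) \<and> D \<le> v (c - y j)"
    and "0 \<le> r" "r < 1" "v (z - c) \<le> r * D"
  shows "1 - (\<Sum>j\<in>J. v (W j) / d j) / (1 - r) \<le> v (1 + (\<Sum>j\<in>J. W j / (z - y j)))"
proof -
  have "v (\<Sum>j\<in>J. W j / (z - y j)) \<le> (\<Sum>j\<in>J. v (W j) / d j) / (1 - r)"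
    using assms by (rule partial_fractions_bound)
  then show ?thesis
    using triangle_lower[of 1 "\<Sum>j\<in>J. W j / (z - y j)"] by simp
qed

text \<open>By \<open>disc_avoids_node\<close>, the difference of the reciprocals \<open>1 / (w - y\<^sub>j)\<close> and \<open>1 / (z - y\<^sub>j)\<close>
  is at most the increment of \<open>1 / (1 - r)\<close> divided by \<open>d\<^sub>j\<close>.\<close>

lemma denominator_variation:
  fixes W y :: "'i \<Rightarrow> 'a"
  assumes d: "\<And>j. j \<in> J \<Longrightarrow> 0 < d j \<and> d j \<le> v (c - y j) \<and> 0 < D \<and> D \<le> v (c - y j)"
    and r: "0 \<le> r" "r \<le> r'" "r' < 1" "v (w - c) \<le> r * D" "v (z - w) \<le> (r' - r) * D"
  defines "S \<equiv> \<Sum>j\<in>J. v (W j) / d j"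
  shows "v ((1 + (\<Sum>j\<in>J. W j / (w - y j))) - (1 + (\<Sum>j\<in>J. W j / (z - y j))))
           \<le> S / (1 - r') - S / (1 - r)"
proof -
  have z: "v (z - c) \<le> r' * D"
    using diff_triangle[of z c w] r by (simp add: algebra_simps)
  have "v ((1 + (\<Sum>j\<in>J. W j / (w - y j))) - (1 + (\<Sum>j\<in>J. W j / (z - y j))))
      = v (\<Sum>j\<in>J. W j / (w - y j) - W j / (z - y j))"
    by (simp add: sum_subtractf)
  also have "\<dots> \<le> (\<Sum>j\<in>J. v (W j / (w - y j) - W j / (z - y j)))" by (rule sum_le)
  also have "\<dots> \<le> (\<Sum>j\<in>J. v (W j) / d j * ((r' - r) / ((1 - r) * (1 - r'))))"
  proof (rule sum_mono)
    fix j assume j: "j \<in> J"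
    let ?\<rho> = "v (c - y j)"
    note dj = d[OF j]
    have w': "(1 - r) * ?\<rho> \<le> v (w - y j)" and z': "(1 - r') * ?\<rho> \<le> v (z - y j)"
      using disc_avoids_node[of D c "y j"] dj r z by auto
    have pos': "0 < (1 - r) * ?\<rho>" "0 < (1 - r') * ?\<rho>" using dj r by (auto intro!: mult_pos_pos)
    then have "w - y j \<noteq> 0" "z - y j \<noteq> 0" using w' z' by (auto simp flip: eq_zero_iff)
    then have "W j / (w - y j) - W j / (z - y j) = W j * (z - w) / ((w - y j) * (z - y j))"
      by (simp add: field_simps)
    then have "v (W j / (w - y j) - W j / (z - y j))
        = v (W j) * v (z - w) / (v (w - y j) * v (z - y j))"
      by (simp add: mult divide)
    also have "\<dots> \<le> v (W j) * ((r' - r) * ?\<rho>) / (((1 - r) * ?\<rho>) * ((1 - r') * ?\<rho>))"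
    proof (rule frac_le)
      have "v (z - w) \<le> (r' - r) * ?\<rho>"
        using r dj by (intro order_trans[OF r(5)] mult_left_mono) auto
      then show "v (W j) * v (z - w) \<le> v (W j) * ((r' - r) * ?\<rho>)"
        using nonneg by (intro mult_left_mono)
    qed (use w' z' pos' r dj nonneg in \<open>auto intro!: mult_mono mult_pos_pos\<close>)
    also have "\<dots> = v (W j) / ?\<rho> * ((r' - r) / ((1 - r) * (1 - r')))"
      using dj by simp
    also have "\<dots> \<le> v (W j) / d j * ((r' - r) / ((1 - r) * (1 - r')))"
      using dj r nonneg by (intro mult_right_mono divide_left_mono) auto
    finally show "v (W j / (w - y j) - W j / (z - y j))
      \<le> v (W j) / d j * ((r' - r) / ((1 - r) * (1 - r')))" .
  qed
  also have "\<dots> = S * ((r' - r) / ((1 - r) * (1 - r')))"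
    unfolding S_def by (rule sum_distrib_right[symmetric])
  also have "\<dots> = S / (1 - r') - S / (1 - r)"
    using r by (simp add: divide_simps) (simp add: algebra_simps)
  finally show ?thesis .
qed

end

text \<open>The hypothesis on \<open>t\<close> says that \<open>t\<close> is a supersolution of the scalar equation
  \<open>r = e / (1 - S / (1 - r))\<close>, whose right side majorizes the fixed point map.\<close>

lemma root_in_disc:
  fixes v :: "'a :: alg_closed_field \<Rightarrow> real" and f :: "'a poly" and x :: "'a ^ 'n"
    and d :: "'n \<Rightarrow> real" and i :: 'n
  defines "S \<equiv> \<Sum>j\<in>UNIV - {i}. v (weierstrass_correction f x $ j) / d j"
  assumes "absolute_value v" and deg: "degree f = CARD('n)"
    and inj: "\<And>i j. i \<noteq> j \<Longrightarrow> x $ i \<noteq> x $ j"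
    and d: "\<And>i. 0 < d i" "\<And>i j. i \<noteq> j \<Longrightarrow> d i \<le> v (x $ i - x $ j)"
    and t: "0 \<le> t" "t < 1" "S < 1 - t"
    and super: "v (weierstrass_correction f x $ i) / d i \<le> t * (1 - S / (1 - t))"
  shows "\<exists>\<zeta>. poly f \<zeta> = 0 \<and> v (\<zeta> - x $ i) \<le> t * d i"
proof (rule ccontr)
  assume far: "\<not> (\<exists>\<zeta>. poly f \<zeta> = 0 \<and> v (\<zeta> - x $ i) \<le> t * d i)"
  interpret absolute_value v by fact
  let ?W = "\<lambda>j. weierstrass_correction f x $ j"
  let ?c = "x $ i"
  define A where "A z = 1 + (\<Sum>j\<in>UNIV - {i}. ?W j / (z - x $ j))" for z
  define B where "B r = 1 - S / (1 - r)" for r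
  define G where "G z = ?c - ?W i / A z" for z
  define e where "e = v (?W i) / d i"
  have f0: "f \<noteq> 0" using deg by (metis degree_0 zero_less_card_finite less_irrefl)
  have nodes: "0 < d j \<and> d j \<le> v (?c - x $ j) \<and> 0 < d i \<and> d i \<le> v (?c - x $ j)"
    if "j \<in> UNIV - {i}" for j
    using that d(1)[of j] d(1)[of i] d(2)[of i j] d(2)[of j i] diff_commute[of "?c" "x $ j"] by auto
  have S0: "0 \<le> S" unfolding S_def using nonneg d by (intro sum_nonneg divide_nonneg_pos) auto
  have e0: "0 \<le> e" unfolding e_def using nonneg d by (intro divide_nonneg_pos) auto
  have Bt: "0 < B t" using t by (simp add: B_def)
  have Bmono: "B r' \<le> B r" if "r \<le> r'" "r' \<le> t" for r r'
    unfolding B_def using that t S0 by (simp add: frac_le)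
  have Bpos: "0 < B r" if "r \<le> t" for r using Bmono[OF that] Bt by simp
  have A: "B r \<le> v (A z)" if "0 \<le> r" "r \<le> t" "v (z - ?c) \<le> r * d i" for r z
    unfolding A_def B_def S_def
    using that t nodes by (intro denominator_lower_bound[where c = ?c and D = "d i"]) auto
  have approx: "\<exists>z. v (z - ?c) \<le> t * d i \<and> v (G z - z) < \<epsilon>" if "0 < \<epsilon>" for \<epsilon>
  proof (rule majorant_approximate_fixed_point[where m = "\<lambda>r. e / B r"])
    have "B 0 \<le> v (A ?c)" using A[of 0 ?c] t by simp
    then have "v (?W i) / v (A ?c) \<le> v (?W i) / B 0"
      using Bpos[of 0] t nonneg by (intro divide_left_mono) auto
    then show "v (G ?c - ?c) \<le> e / B 0 * d i"
      using d(1)[of i] by (simp add: G_def divide e_def)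
    show "0 \<le> e / B 0" using e0 Bpos[of 0] t by simp
    show "e / B r \<le> e / B r'" if "0 \<le> r" "r \<le> r'" "r' \<le> t" for r r'
      using that e0 Bmono[of r r'] Bpos[of r] Bpos[of r'] by (intro divide_left_mono) auto
    show "e / B t \<le> t"
      using super unfolding pos_divide_le_eq[OF Bt] by (simp only: e_def B_def)
  next
    fix w z r r'
    assume r: "0 \<le> r" "r \<le> r'" "r' \<le> t" "v (w - ?c) \<le> r * d i" "v (z - w) \<le> (r' - r) * d i"
    have z: "v (z - ?c) \<le> r' * d i"
      using diff_triangle[of z ?c w] r by (simp add: algebra_simps)
    have lower: "B r \<le> v (A w)" "B r' \<le> v (A z)" using A r z by auto
    have Bp: "0 < B r" "0 < B r'" using Bpos r by auto
    have "A w \<noteq> 0" "A z \<noteq> 0" using lower Bp by (auto simp flip: eq_zero_iff)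
    then have "G z - G w = ?W i * (A z - A w) / (A w * A z)"
      by (simp add: G_def field_simps)
    then have "v (G z - G w) = v (?W i) * v (A z - A w) / (v (A w) * v (A z))"
      by (simp add: mult divide)
    also have "\<dots> \<le> v (?W i) * (B r - B r') / (B r * B r')"
    proof (rule frac_le)
      have "v (A w - A z) \<le> B r - B r'"
        using denominator_variation[of "UNIV - {i}" d ?c "\<lambda>j. x $ j" "d i" r r' w z ?W] r nodes t
        by (auto simp: A_def B_def S_def)
      then show "v (?W i) * v (A z - A w) \<le> v (?W i) * (B r - B r')"
        using nonneg by (simp add: diff_commute[of "A z"] mult_left_mono)
    qed (use lower Bp nonneg Bmono[of r r'] r in \<open>auto intro!: mult_mono\<close>)
    also have "\<dots> = (e / B r' - e / B r) * d i"
      using Bp d(1)[of i] by (simp add: e_def field_simps)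
    finally show "v (G z - G w) \<le> (e / B r' - e / B r) * d i" .
  qed (use t d that in auto)
  \<comment> \<open>On the disc \<open>f z\<close> is bounded by a multiple of the defect \<open>z - G z\<close>.\<close>
  define C where "C = v (lead_coeff f) * (\<Prod>j\<in>UNIV - {i}. t * d i + v (?c - x $ j)) * (1 + S / (1 - t))"
  have small: "v (poly f z) \<le> C * v (G z - z)" if z: "v (z - ?c) \<le> t * d i" for z
  proof -
    have lower: "(1 - t) * v (?c - x $ j) \<le> v (z - x $ j)" if "j \<noteq> i" for j
      using disc_avoids_node[of "d i" ?c "x $ j" z t] nodes[of j] that z t by auto
    have off: "z \<noteq> x $ j" if "j \<noteq> i" for j
    proof -
      have "0 < (1 - t) * v (?c - x $ j)" using nodes[of j] that t by simp
      then show ?thesis using lower[OF that] by auto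
    qed
    have "A z \<noteq> 0" using A[of t z] z t Bt by (auto simp flip: eq_zero_iff)
    then have "(z - ?c) * A z + ?W i = (z - G z) * A z"
      by (simp add: G_def field_simps)
    then have "poly f z = lead_coeff f * (\<Prod>j\<in>UNIV - {i}. z - x $ j) * ((z - G z) * A z)"
      using weierstrass_fixed_point_form[OF deg inj off] by (simp add: A_def)
    then have "v (poly f z) = v (lead_coeff f) * (\<Prod>j\<in>UNIV - {i}. v (z - x $ j)) * v (A z) * v (G z - z)"
      by (simp add: mult prod diff_commute[of z "G z"])
    also have "\<dots> \<le> C * v (G z - z)"
      unfolding C_def
    proof (intro mult_right_mono mult_mono mult_left_mono prod_mono conjI)
      fix j
      show "v (z - x $ j) \<le> t * d i + v (?c - x $ j)"
        using diff_triangle[of z "x $ j" ?c] z by simp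
    next
      have "v (\<Sum>j\<in>UNIV - {i}. ?W j / (z - x $ j)) \<le> S / (1 - t)"
        unfolding S_def using t nodes z
        by (intro partial_fractions_bound[where c = ?c and D = "d i"]) auto
      then show "v (A z) \<le> 1 + S / (1 - t)"
        using triangle[of 1 "\<Sum>j\<in>UNIV - {i}. ?W j / (z - x $ j)"] by (simp add: A_def)
    qed (use nonneg t S0 d(1) in \<open>auto intro!: prod_nonneg add_nonneg_nonneg mult_nonneg_nonneg simp: less_imp_le\<close>)
    finally show ?thesis .
  qed
  \<comment> \<open>As \<open>f\<close> has finitely many roots, the assumption separates them from the disc by some \<open>\<delta>\<close>.\<close>
  define R where "R = {\<zeta>. poly f \<zeta> = 0}"
  define \<delta> where "\<delta> = Min (insert 1 ((\<lambda>\<zeta>. v (\<zeta> - ?c) - t * d i) ` R))"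
  have fin: "finite R" unfolding R_def using f0 by (rule poly_roots_finite)
  have \<delta>0: "0 < \<delta>" unfolding \<delta>_def using fin far by (auto simp: R_def not_le)
  have \<delta>le: "\<delta> \<le> v (\<zeta> - ?c) - t * d i" if "poly f \<zeta> = 0" for \<zeta>
    unfolding \<delta>_def using fin that by (intro Min_le) (auto simp: R_def)
  define \<mu> where "\<mu> = v (lead_coeff f) * \<delta> ^ degree f"
  have \<mu>: "0 < \<mu>" unfolding \<mu>_def using \<delta>0 f0 by (intro mult_pos_pos pos) auto
  have C0: "0 \<le> C" unfolding C_def using nonneg t S0 d(1)
    by (intro mult_nonneg_nonneg prod_nonneg add_nonneg_nonneg) (auto simp: less_imp_le)
  obtain z where z: "v (z - ?c) \<le> t * d i" "v (G z - z) < \<mu> / (C + 1)"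
    using approx[of "\<mu> / (C + 1)"] \<mu> C0 by auto
  have "v (poly f z) \<le> C * v (G z - z)" using small z by blast
  also have "\<dots> \<le> C * (\<mu> / (C + 1))" using z C0 by (intro mult_left_mono) auto
  also have "\<dots> < \<mu>" using \<mu> C0 by (simp add: field_simps)
  finally obtain \<zeta> where \<zeta>: "poly f \<zeta> = 0" "v (z - \<zeta>) < \<delta>"
    using small_value_imp_near_root[OF \<open>absolute_value v\<close> f0 \<delta>0] unfolding \<mu>_def by blast
  have "v (\<zeta> - ?c) \<le> v (z - \<zeta>) + v (z - ?c)"
    using diff_triangle[of \<zeta> ?c z] by (simp add: diff_commute[of z \<zeta>])
  then show False using \<zeta> \<delta>le[OF \<zeta>(1)] z by simp
qed

text \<open>A root known to lie in the disc satisfies the fixed point equation exactly; its distance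
  from the centre is therefore bounded by a multiple of the \<open>i\<close>-th correction, which is what makes
  an estimate in the \<open>p\<close>-norm possible.\<close>

lemma root_distance_le_correction:
  fixes v :: "'a :: field \<Rightarrow> real" and f :: "'a poly" and x :: "'a ^ 'n"
    and d :: "'n \<Rightarrow> real" and i :: 'n
  defines "S \<equiv> \<Sum>j\<in>UNIV - {i}. v (weierstrass_correction f x $ j) / d j"
  assumes "absolute_value v" and deg: "degree f = CARD('n)"
    and inj: "\<And>i j. i \<noteq> j \<Longrightarrow> x $ i \<noteq> x $ j"
    and d: "\<And>i. 0 < d i" "\<And>i j. i \<noteq> j \<Longrightarrow> d i \<le> v (x $ i - x $ j)"
    and t: "0 \<le> t" "t < 1"
    and \<zeta>: "poly f \<zeta> = 0" "v (\<zeta> - x $ i) \<le> t * d i"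
  shows "v (\<zeta> - x $ i) * (1 - S / (1 - t)) \<le> v (weierstrass_correction f x $ i)"
proof -
  interpret absolute_value v by fact
  let ?W = "\<lambda>j. weierstrass_correction f x $ j"
  let ?A = "1 + (\<Sum>j\<in>UNIV - {i}. ?W j / (\<zeta> - x $ j))"
  have nodes: "0 < d j \<and> d j \<le> v (x $ i - x $ j) \<and> d i \<le> v (x $ i - x $ j)" if "j \<in> UNIV - {i}" for j
    using that d(1)[of j] d(2)[of i j] d(2)[of j i] diff_commute[of "x $ i" "x $ j"] by auto
  have off: "\<zeta> \<noteq> x $ j" if "j \<noteq> i" for j
  proof -
    have "0 < (1 - t) * v (x $ i - x $ j)" using nodes[of j] that t by simp
    also have "\<dots> \<le> v (\<zeta> - x $ j)" using disc_avoids_node[of "d i"] nodes[of j] that \<zeta> t by auto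
    finally show ?thesis by auto
  qed
  have "lead_coeff f \<noteq> 0" using deg by (metis degree_0 leading_coeff_0_iff zero_less_card_finite less_irrefl)
  moreover have "(\<Prod>j\<in>UNIV - {i}. \<zeta> - x $ j) \<noteq> 0" using off by auto
  ultimately have "(\<zeta> - x $ i) * ?A = - ?W i"
    using weierstrass_fixed_point_form[OF deg inj off] \<zeta>(1) by (auto simp: add_eq_0_iff)
  then have "v (\<zeta> - x $ i) * v ?A = v (?W i)" by (metis mult minus)
  moreover have "1 - S / (1 - t) \<le> v ?A"
    unfolding S_def using nodes t \<zeta> by (intro denominator_lower_bound) auto
  then have "v (\<zeta> - x $ i) * (1 - S / (1 - t)) \<le> v (\<zeta> - x $ i) * v ?A"
    using nonneg by (intro mult_left_mono)
  ultimately show ?thesis by simp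
qed

section \<open>Estimates in the \<open>p\<close>-norm\<close>

text \<open>The Hoelder inequality with a constant factor, as Jensen's inequality for \<open>y powr p\<close>.\<close>

lemma sum_le_card_powr_sum_powr:
  fixes y :: "'i \<Rightarrow> real" and p :: real
  assumes p: "1 \<le> p" and "finite A" and y: "\<And>j. j \<in> A \<Longrightarrow> 0 \<le> y j"
  shows "(\<Sum>j\<in>A. y j) \<le> real (card A) powr (1 - 1 / p) * (\<Sum>j\<in>A. y j powr p) powr (1 / p)"
proof -
  \<comment> \<open>Jensen's inequality is applied on the open half line, so zero terms are dropped.\<close>
  define P where "P = {j \<in> A. 0 < y j}"
  have fin: "finite P" using \<open>finite A\<close> by (simp add: P_def)
  have sub: "P \<subseteq> A" by (auto simp: P_def)
  have "(\<Sum>j\<in>A. y j) = (\<Sum>j\<in>P. y j)"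
    using y \<open>finite A\<close> by (intro sum.mono_neutral_right) (force simp: P_def)+
  also have "\<dots> \<le> real (card P) powr (1 - 1 / p) * (\<Sum>j\<in>P. y j powr p) powr (1 / p)"
  proof (cases "P = {}")
    case False
    define m where "m = real (card P)"
    have m: "0 < m" using fin False by (simp add: m_def card_gt_0_iff)
    have s0: "0 < (\<Sum>j\<in>P. y j)" using fin False by (intro sum_pos) (auto simp: P_def)
    have "(\<Sum>j\<in>P. (1 / m) *\<^sub>R y j) powr p \<le> (\<Sum>j\<in>P. (1 / m) * y j powr p)"
      using p m False fin
      by (intro convex_on_sum[OF _ _ powr_convex]) (auto simp: P_def m_def)
    then have "((\<Sum>j\<in>P. y j) / m) powr p \<le> (\<Sum>j\<in>P. y j powr p) / m"
      by (simp flip: sum_divide_distrib)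
    then have "(((\<Sum>j\<in>P. y j) / m) powr p) powr (1 / p) \<le> ((\<Sum>j\<in>P. y j powr p) / m) powr (1 / p)"
      using p by (intro powr_mono2) auto
    then have "(\<Sum>j\<in>P. y j) / m \<le> (\<Sum>j\<in>P. y j powr p) powr (1 / p) / m powr (1 / p)"
      using p m s0 by (simp add: powr_powr powr_divide sum_nonneg)
    then have "(\<Sum>j\<in>P. y j) \<le> (m powr 1 / m powr (1 / p)) * (\<Sum>j\<in>P. y j powr p) powr (1 / p)"
      using m by (simp add: field_simps)
    then show ?thesis by (simp add: powr_diff m_def)
  qed simp
  also have "\<dots> \<le> real (card A) powr (1 - 1 / p) * (\<Sum>j\<in>A. y j powr p) powr (1 / p)"
    using p sub \<open>finite A\<close>
    by (intro mult_mono powr_mono2 sum_mono2) (auto intro!: card_mono sum_nonneg)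
  finally show ?thesis .
qed

lemma conjugate_exponents_finite:
  assumes "conjugate_exponents p q" "p \<noteq> \<infinity>"
  shows "1 \<le> enn2real p" "enn2real (1 / q) = 1 - 1 / enn2real p"
proof -
  obtain r where r: "p = ennreal r" "0 \<le> r" using assms(2) by (cases p) auto
  have "1 \<le> p" and eq: "1 / p + 1 / q = 1" using assms(1) by (auto simp: conjugate_exponents_def)
  then have r1: "1 \<le> r" using r by (metis ennreal_1 ennreal_le_iff)
  then show "1 \<le> enn2real p" using r by simp
  have p: "1 / p = ennreal (1 / r)" using r r1 by (simp flip: ennreal_1 add: divide_ennreal)
  then have "1 / q \<noteq> \<infinity>" using eq by (auto simp: ennreal_add_eq_top)
  then obtain s where s: "1 / q = ennreal s" "0 \<le> s" by (cases "1 / q") auto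
  have "ennreal (1 / r + s) = ennreal 1" using eq p s r1 by simp
  then have "1 / r + s = 1" using r1 s by (subst (asm) ennreal_inj) auto
  then show "enn2real (1 / q) = 1 - 1 / enn2real p" using r s by simp
qed

lemma conjugate_exponents_infinite:
  assumes "conjugate_exponents \<infinity> q"
  shows "enn2real (1 / q) = 1"
  using assms by (simp add: conjugate_exponents_def)

lemma abs_component_le_p_norm:
  fixes y :: "real ^ 'n"
  assumes "1 \<le> p"
  shows "\<bar>y $ i\<bar> \<le> p_norm p y"
proof (cases "p = \<infinity>")
  case True
  then show ?thesis by (simp add: p_norm_def)
next
  case False
  then have p: "1 \<le> enn2real p"
    using assms by (cases p) (auto simp flip: ennreal_1 simp: ennreal_le_iff)
  have "\<bar>y $ i\<bar> = (\<bar>y $ i\<bar> powr enn2real p) powr (1 / enn2real p)"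
    using p by (simp add: powr_powr)
  also have "\<dots> \<le> p_norm p y"
    using False p by (auto simp: p_norm_def intro!: powr_mono2 member_le_sum)
  finally show ?thesis .
qed

lemma p_norm_mono_scaled:
  fixes y w :: "real ^ 'n"
  assumes "1 \<le> p" "0 \<le> c" "\<And>i. \<bar>y $ i\<bar> \<le> c * \<bar>w $ i\<bar>"
  shows "p_norm p y \<le> c * p_norm p w"
proof (cases "p = \<infinity>")
  case True
  have "c * \<bar>w $ i\<bar> \<le> c * p_norm \<infinity> w" for i
    using assms(2) abs_component_le_p_norm[of \<infinity> w i] by (intro mult_left_mono) auto
  then have "\<bar>y $ i\<bar> \<le> c * p_norm \<infinity> w" for i
    using assms(3) order_trans by blast
  then show ?thesis using True by (simp add: p_norm_def)
next
  case False
  then have p: "1 \<le> enn2real p"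
    using assms(1) by (cases p) (auto simp flip: ennreal_1 simp: ennreal_le_iff)
  let ?p = "enn2real p"
  have "(\<Sum>i\<in>UNIV. \<bar>y $ i\<bar> powr ?p) \<le> (\<Sum>i\<in>UNIV. (c * \<bar>w $ i\<bar>) powr ?p)"
    using assms(3) p by (intro sum_mono powr_mono2) auto
  also have "\<dots> = c powr ?p * (\<Sum>i\<in>UNIV. \<bar>w $ i\<bar> powr ?p)"
    using assms(2) by (simp add: powr_mult sum_distrib_left)
  finally have "(\<Sum>i\<in>UNIV. \<bar>y $ i\<bar> powr ?p) powr (1 / ?p)
      \<le> (c powr ?p * (\<Sum>i\<in>UNIV. \<bar>w $ i\<bar> powr ?p)) powr (1 / ?p)"
    using p by (intro powr_mono2) (auto intro!: sum_nonneg)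
  also have "\<dots> = c * (\<Sum>i\<in>UNIV. \<bar>w $ i\<bar> powr ?p) powr (1 / ?p)"
    using p assms(2) by (simp add: powr_mult powr_powr sum_nonneg)
  finally show ?thesis using False by (simp add: p_norm_def)
qed

lemma holder_sum_others:
  fixes y :: "real ^ 'n"
  assumes "conjugate_exponents p q"
  shows "(\<Sum>j\<in>UNIV - {i}. \<bar>y $ j\<bar>) \<le> (real CARD('n) - 1) powr enn2real (1 / q) * p_norm p y"
proof -
  have card: "real (card (UNIV - {i} :: 'n set)) = real CARD('n) - 1"
    by (simp add: card_Diff_singleton of_nat_diff Suc_le_eq)
  have n1: "0 \<le> real CARD('n) - 1" using card by (metis of_nat_0_le_iff)
  show ?thesis
  proof (cases "p = \<infinity>")
    case True
    have "(\<Sum>j\<in>UNIV - {i}. \<bar>y $ j\<bar>) \<le> (\<Sum>j\<in>UNIV - {i}. p_norm p y)"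
      using True by (intro sum_mono abs_component_le_p_norm) auto
    also have "\<dots> = (real CARD('n) - 1) * p_norm p y"
      using card by simp
    finally show ?thesis
      using True assms conjugate_exponents_infinite[of q] n1 by simp
  next
    case False
    note p = conjugate_exponents_finite[OF assms False]
    have "(\<Sum>j\<in>UNIV - {i}. \<bar>y $ j\<bar>) \<le> (real CARD('n) - 1) powr enn2real (1 / q)
        * (\<Sum>j\<in>UNIV - {i}. \<bar>y $ j\<bar> powr enn2real p) powr (1 / enn2real p)"
      using sum_le_card_powr_sum_powr[of "enn2real p" "UNIV - {i}" "\<lambda>j. \<bar>y $ j\<bar>"] p card by simp
    moreover have "(\<Sum>j\<in>UNIV - {i}. \<bar>y $ j\<bar> powr enn2real p) \<le> (\<Sum>j\<in>UNIV. \<bar>y $ j\<bar> powr enn2real p)"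
      by (intro sum_mono2) auto
    then have "(\<Sum>j\<in>UNIV - {i}. \<bar>y $ j\<bar> powr enn2real p) powr (1 / enn2real p) \<le> p_norm p y"
      using False p by (simp add: p_norm_def powr_mono2 sum_nonneg)
    then have "(real CARD('n) - 1) powr enn2real (1 / q)
        * (\<Sum>j\<in>UNIV - {i}. \<bar>y $ j\<bar> powr enn2real p) powr (1 / enn2real p)
      \<le> (real CARD('n) - 1) powr enn2real (1 / q) * p_norm p y"
      by (intro mult_left_mono) auto
    ultimately show ?thesis by (rule order_trans)
  qed
qed

text \<open>This excludes colliding roots for finite \<open>p\<close>: a collision would need two components equal
  to the whole norm bound.\<close>

lemma p_norm_two_large_components:
  fixes y :: "real ^ 'n"
  assumes "1 \<le> p" "p \<noteq> \<infinity>" "i \<noteq> j" "0 < s" "s \<le> \<bar>y $ i\<bar>" "s \<le> \<bar>y $ j\<bar>"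
  shows "s < p_norm p y"
proof -
  let ?p = "enn2real p"
  have p: "1 \<le> ?p"
    using assms(1,2) by (cases p) (auto simp flip: ennreal_1 simp: ennreal_le_iff)
  have "s powr ?p \<le> \<bar>y $ k\<bar> powr ?p" if "k \<in> {i, j}" for k
    using assms p that by (intro powr_mono2) auto
  then have "s powr ?p + s powr ?p \<le> \<bar>y $ i\<bar> powr ?p + \<bar>y $ j\<bar> powr ?p"
    by (intro add_mono) auto
  also have "\<dots> = (\<Sum>k\<in>{i, j}. \<bar>y $ k\<bar> powr ?p)" using \<open>i \<noteq> j\<close> by simp
  also have "\<dots> \<le> (\<Sum>k\<in>UNIV. \<bar>y $ k\<bar> powr ?p)" by (intro sum_mono2) auto
  finally have "s powr ?p < (\<Sum>k\<in>UNIV. \<bar>y $ k\<bar> powr ?p)" using \<open>0 < s\<close> by (smt (verit) powr_gt_zero)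
  then have "(s powr ?p) powr (1 / ?p) < (\<Sum>k\<in>UNIV. \<bar>y $ k\<bar> powr ?p) powr (1 / ?p)"
    using p by (intro powr_less_mono2) auto
  then show ?thesis using assms p by (simp add: powr_powr p_norm_def)
qed

section \<open>The scalar equation\<close>

text \<open>The bound \<open>t\<close> of the theorem is the smaller root of \<open>t\<^sup>2 - (1 - (a - 1) E) t + E = 0\<close>,
  equivalently a solution of \<open>t = E / (1 - a E / (1 - t))\<close>; the bound on \<open>E\<close> is the maximum of
  \<open>t (1 - t) / (1 + (a - 1) t)\<close> on the unit interval, attained at \<open>t = 1 / (1 + sqrt a)\<close>.\<close>

lemma majorant_root:
  fixes a E :: real
  assumes a: "1 \<le> a" and E: "0 \<le> E" "E \<le> 1 / (1 + sqrt a)\<^sup>2"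
  defines "t \<equiv> 2 * E / (1 - (a - 1) * E + sqrt ((1 - (a - 1) * E)\<^sup>2 - 4 * E))"
  shows "0 \<le> t" "t \<le> 1 / (1 + sqrt a)" "E < 1 / (1 + sqrt a)\<^sup>2 \<Longrightarrow> t < 1 / (1 + sqrt a)"
    and "a * E < 1 - t" "t * (1 - a * E / (1 - t)) = E"
proof -
  define s where "s = sqrt a"
  have s: "1 \<le> s" "a = s\<^sup>2" using a by (auto simp: s_def)
  define b where "b = 1 - (a - 1) * E"
  define R where "R = sqrt (b\<^sup>2 - 4 * E)"
  have "(a - 1) * E \<le> (s - 1) * (1 + s) * (1 / (1 + s)\<^sup>2)"
    using s E a unfolding s_def[symmetric]
    by (intro mult_mono) (auto simp: power2_eq_square algebra_simps)
  also have "\<dots> = (s - 1) / (1 + s)" using s by (simp add: power2_eq_square)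
  also have "\<dots> = 1 - 2 / (1 + s)" using s by (simp add: field_simps)
  finally have b: "2 / (1 + s) \<le> b" by (simp add: b_def)
  then have b0: "0 < b" using s by (smt (verit) divide_pos_pos)
  have "4 * E \<le> (2 / (1 + s))\<^sup>2" using E by (simp add: s_def power_divide)
  also have "\<dots> \<le> b\<^sup>2" using b s by (intro power_mono) auto
  finally have disc: "0 \<le> b\<^sup>2 - 4 * E" by simp
  then have R: "0 \<le> R" "R\<^sup>2 = b\<^sup>2 - 4 * E" by (auto simp: R_def)
  have t: "t = 2 * E / (b + R)" by (simp add: t_def b_def R_def)
  have "t * (b + R) = 2 * E" using t b0 R by simp
  moreover have "(b - R) * (b + R) = 4 * E"
    using R(2) by (simp add: algebra_simps power2_eq_square)
  ultimately have "(2 * t) * (b + R) = (b - R) * (b + R)" by simp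
  then have "2 * t = b - R" using b0 R(1) by simp
  then have "(b - 2 * t)\<^sup>2 = b\<^sup>2 - 4 * E" using R(2) by simp
  then have "t * t - b * t + E = 0" by (simp add: power2_eq_square algebra_simps)
  then have quad: "E * (1 + (a - 1) * t) = t * (1 - t)" by (simp add: b_def algebra_simps)
  show t0: "0 \<le> t" using t b0 R E by simp
  have tb: "t \<le> 2 * E / b" unfolding t using b0 R E by (intro divide_left_mono) auto
  have up: "2 * E' / b \<le> E' * (1 + s)" if "0 \<le> E'" for E'
  proof -
    have "2 * E' / b \<le> 2 * E' / (2 / (1 + s))" using b b0 s that by (intro divide_left_mono) auto
    then show ?thesis by simp
  qed
  have max: "1 / (1 + s)\<^sup>2 * (1 + s) = 1 / (1 + s)" using s by (simp add: power2_eq_square)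
  have "E * (1 + s) \<le> 1 / (1 + s)\<^sup>2 * (1 + s)"
    using E s unfolding s_def[symmetric] by (intro mult_right_mono) auto
  then show t1: "t \<le> 1 / (1 + sqrt a)" using tb up[OF E(1)] max by (simp add: s_def)
  show "t < 1 / (1 + sqrt a)" if "E < 1 / (1 + sqrt a)\<^sup>2"
  proof -
    have "E * (1 + s) < 1 / (1 + s)\<^sup>2 * (1 + s)"
      using that s unfolding s_def[symmetric] by (intro mult_strict_right_mono) auto
    then show ?thesis using tb up[OF E(1)] max by (simp add: s_def)
  qed
  have "1 / (1 + s) < 1" using s by simp
  then have lt1: "t < 1" using t1 by (simp add: s_def)
  have pos: "0 < 1 + (a - 1) * t" using a t0 by (simp add: add_pos_nonneg)
  have "a * E * (1 + (a - 1) * t) = a * t * (1 - t)" using quad by (simp add: mult.assoc)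
  also have "\<dots> < (1 + (a - 1) * t) * (1 - t)"
    using lt1 by (intro mult_strict_right_mono) (auto simp: algebra_simps)
  finally show "a * E < 1 - t" using pos by (simp add: mult.commute)
  show "t * (1 - a * E / (1 - t)) = E"
    using quad lt1 by (simp add: field_simps)
qed

lemma min_dist_pos_le:
  fixes x :: "'a :: field ^ 'n"
  assumes "absolute_value v" "CARD('n) \<ge> 2" "\<And>i j. i \<noteq> j \<Longrightarrow> x $ i \<noteq> x $ j"
  shows "0 < min_dist v x $ i" "i \<noteq> j \<Longrightarrow> min_dist v x $ i \<le> v (x $ i - x $ j)"
proof -
  interpret absolute_value v by fact
  have "UNIV - {i} \<noteq> {}"
  proof
    assume "UNIV - {i} = {}"
    then have "(UNIV :: 'n set) = {i}" by auto
    then show False using assms(2) 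
      by (metis card_1_singleton_iff One_nat_def not_less_eq_eq numeral_2_eq_2 order_refl)
  qed
  then show "0 < min_dist v x $ i"
    using assms(3) by (auto simp: min_dist_def intro!: pos)
  show "i \<noteq> j \<Longrightarrow> min_dist v x $ i \<le> v (x $ i - x $ j)"
    by (auto simp: min_dist_def intro!: Min_le)
qed

section \<open>Localization of the roots\<close>

theorem theorem5p1:
  fixes v :: "'a :: alg_closed_field \<Rightarrow> real"
    and f :: "'a poly"
    and x :: "'a ^ 'n"
    and p q :: ennreal
    and a E :: real
  assumes "absolute_value v"
    and "degree f = CARD('n)"
    and "CARD('n) \<ge> 2"
    and "conjugate_exponents p q"
    and "\<And>i j. i \<noteq> j \<Longrightarrow> x $ i \<noteq> x $ j"
    and "a = (real CARD('n) - 1) powr enn2real (1 / q)"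
    and "E = E_func v p f x"
    and "E \<le> 1 / (1 + sqrt a)\<^sup>2"
    and "CARD('n) = 2 \<Longrightarrow> p = \<infinity> \<Longrightarrow> E < 1 / (1 + sqrt a)\<^sup>2"
  shows "(\<forall>z. poly f z = 0 \<longrightarrow> order z f = 1) \<and>
         (\<exists>\<xi> :: 'a ^ 'n. is_root_vector f \<xi> \<and>
            p_norm p (vec_quotient v (x - \<xi>) (min_dist v x))
              \<le> 2 * E / (1 - (a - 1) * E + sqrt ((1 - (a - 1) * E)\<^sup>2 - 4 * E)))"
proof -
  interpret absolute_value v by fact
  define t where "t = 2 * E / (1 - (a - 1) * E + sqrt ((1 - (a - 1) * E)\<^sup>2 - 4 * E))"
  define d where "d = (\<lambda>i. min_dist v x $ i)"
  define e where "e = vec_quotient v (weierstrass_correction f x) (min_dist v x)"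
  define S where "S i = (\<Sum>j\<in>UNIV - {i}. v (weierstrass_correction f x $ j) / d j)" for i
  have d: "0 < d i" "i \<noteq> j \<Longrightarrow> d i \<le> v (x $ i - x $ j)" for i j
    using min_dist_pos_le[OF assms(1,3,5)] by (auto simp: d_def)
  have p1: "1 \<le> p" using assms(4) by (simp add: conjugate_exponents_def)
  have e: "e $ i = v (weierstrass_correction f x $ i) / d i" "\<bar>e $ i\<bar> = e $ i" for i
    using d(1)[of i] nonneg by (auto simp: e_def vec_quotient_def d_def)
  have E: "E = p_norm p e" using assms(7) by (simp add: E_func_def e_def)
  have e_le: "e $ i \<le> E" for i using abs_component_le_p_norm[OF p1, of e i] e E by simp
  have E0: "0 \<le> E" using e_le[of undefined] e(2)[of undefined] by linarith
  have a1: "1 \<le> a" unfolding assms(6) using assms(3) by (intro ge_one_powr_ge_zero) auto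
  note t = majorant_root[OF a1 E0 assms(8), folded t_def]
  have s1: "1 \<le> sqrt a" using a1 by simp
  then have "1 / (1 + sqrt a) \<le> 1 / 2" by (intro frac_le) auto
  then have t_half: "t \<le> 1 / 2" using t(2) by linarith
  have S: "S i \<le> a * E" for i
    unfolding S_def assms(6) E e(1)[symmetric]
    using holder_sum_others[OF assms(4), where y = e and i = i] by (simp only: e(2))
  define b where "b = 1 - a * E / (1 - t)"
  have b: "0 < b" "t * b = E" using t t_half by (auto simp: b_def)
  have bS: "b \<le> 1 - S i / (1 - t)" for i
    unfolding b_def using S t_half by (auto intro!: divide_right_mono)
  have super: "v (weierstrass_correction f x $ i) / d i \<le> t * (1 - S i / (1 - t))" for i
  proof -
    have "e $ i \<le> t * b" using e_le b by simp
    also have "\<dots> \<le> t * (1 - S i / (1 - t))" using bS t by (intro mult_left_mono)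
    finally show ?thesis by (simp add: e)
  qed
  have "\<exists>\<zeta>. poly f \<zeta> = 0 \<and> v (\<zeta> - x $ i) \<le> t * d i" for i
    using root_in_disc[OF assms(1,2,5) d t(1) _ _ super[unfolded S_def]] S[of i] t t_half
    by (auto simp: S_def)
  then obtain \<zeta> where \<zeta>: "poly f (\<zeta> i) = 0" "v (\<zeta> i - x $ i) \<le> t * d i" for i
    by metis
  define \<xi> where "\<xi> = (\<chi> i. \<zeta> i)"
  define u where "u = vec_quotient v (x - \<xi>) (min_dist v x)"
  have u: "u $ i = v (\<zeta> i - x $ i) / d i" "\<bar>u $ i\<bar> = u $ i" for i
    using d(1)[of i] nonneg by (auto simp: u_def vec_quotient_def d_def \<xi>_def diff_commute)
  have "\<bar>u $ i\<bar> \<le> 1 / b * \<bar>e $ i\<bar>" for i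
  proof -
    have "v (\<zeta> i - x $ i) * b \<le> v (\<zeta> i - x $ i) * (1 - S i / (1 - t))"
      using bS nonneg by (intro mult_left_mono)
    also have "\<dots> \<le> v (weierstrass_correction f x $ i)"
      using root_distance_le_correction[OF assms(1,2,5) d t(1) _ \<zeta>] t_half by (simp add: S_def)
    finally show ?thesis using b d(1)[of i] by (simp add: u e abs_of_nonneg[OF nonneg] field_simps)
  qed
  then have "p_norm p u \<le> 1 / b * p_norm p e"
    using p1 b by (intro p_norm_mono_scaled) auto
  also have "\<dots> = t" using b E by (simp add: field_simps)
  finally have norm_u: "p_norm p u \<le> t" .
  have u_le: "u $ i \<le> t" for i
    using abs_component_le_p_norm[OF p1, of u i] norm_u u by simp
  have "inj \<zeta>"
  proof (rule injI, rule ccontr)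
    fix i j assume eq: "\<zeta> i = \<zeta> j" and "i \<noteq> j"
    let ?\<rho> = "v (x $ i - x $ j)"
    have \<rho>: "0 < ?\<rho>" "d i \<le> ?\<rho>" "d j \<le> ?\<rho>"
      using d(1)[of i] d(2)[of i j] d(2)[of j i] \<open>i \<noteq> j\<close> diff_commute[of "x $ i"] by auto
    have "?\<rho> \<le> v (\<zeta> i - x $ i) + v (\<zeta> j - x $ j)"
      using diff_triangle[of "x $ i" "x $ j" "\<zeta> i"] eq by (simp add: diff_commute)
    also have "\<dots> = u $ i * d i + u $ j * d j" using d(1)[of i] d(1)[of j] by (simp add: u)
    also have "\<dots> \<le> u $ i * ?\<rho> + u $ j * ?\<rho>"
      using \<rho> u(2)[of i] u(2)[of j] by (intro add_mono mult_left_mono) linarith+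
    finally have "1 * ?\<rho> \<le> (u $ i + u $ j) * ?\<rho>" by (simp add: algebra_simps)
    then have "1 \<le> u $ i + u $ j" using \<rho>(1) by (rule mult_right_le_imp_le)
    \<comment> \<open>Colliding roots force the extreme case \<open>t = 1/2\<close>, with both components of \<open>u\<close> extremal.\<close>
    then have half: "u $ i = 1 / 2" "u $ j = 1 / 2" "t = 1 / 2"
      using u_le[of i] u_le[of j] t_half by linarith+
    show False
    proof (cases "p = \<infinity>")
      case False
      then have "1 / 2 < p_norm p u"
        using p1 \<open>i \<noteq> j\<close> half by (intro p_norm_two_large_components) auto
      then show False using norm_u half by simp
    next
      case True
      have "1 / 2 \<le> 1 / (1 + sqrt a)" using t(2) half by simp
      then have "1 + sqrt a \<le> 2" using s1 by (simp add: field_simps)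
      then have "sqrt a \<le> 1" by simp
      then have "a \<le> 1" by simp
      moreover have "a = real CARD('n) - 1"
        using assms(3,4,6) True conjugate_exponents_infinite by simp
      ultimately have "CARD('n) = 2" using assms(3) by linarith
      then have "t < 1 / (1 + sqrt a)" using t(3) assms(9) True by blast
      then show False using half \<open>1 / (1 + sqrt a) \<le> 1 / 2\<close> by simp
    qed
  qed
  then have inj: "inj (\<lambda>i. \<xi> $ i)" by (simp add: \<xi>_def)
  have f: "f = smult (lead_coeff f) (\<Prod>i\<in>UNIV. [:- \<xi> $ i, 1:])"
    using assms(2) inj \<zeta> by (intro distinct_roots_imp_root_vector) (auto simp: \<xi>_def)
  have val: "poly f z = lead_coeff f * (\<Prod>i\<in>UNIV. z - \<xi> $ i)" for z
    by (subst f) (simp only: poly_smult poly_linear_prod)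
  have c0: "lead_coeff f \<noteq> 0"
    using assms(2) by (metis degree_0 leading_coeff_0_iff zero_less_card_finite less_irrefl)
  have "order z f = 1" if "poly f z = 0" for z
  proof -
    have "(\<Prod>i\<in>UNIV. z - \<xi> $ i) = 0"
      using that c0 unfolding val[of z] mult_eq_0_iff by blast
    then obtain i where "z = \<xi> $ i" by auto
    then show ?thesis using order_linear_prod[OF _ inj _ c0, of i] f by simp
  qed
  moreover have "is_root_vector f \<xi>" using val by (simp add: is_root_vector_def)
  ultimately show ?thesis using norm_u unfolding u_def t_def by blast
qed

end
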